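(* Let $F:\mathbb{R}^n\to\mathbb{R}^m$ be continuous, $C\in\mathbb{R}^{m\times r}$ with $r\le m$, $\delta\ge 0$, and let $$\varphi(x)=\|F(x)\|^2+2\delta\|C^\top F(x)\|_1+\|C\|_F^2\delta^2 .$$ Let $X^*=\mathop{\mathrm{argmin}}_{x}\|F(x)\|^2$, $\hat X=\mathop{\mathrm{argmin}}_{x}\varphi(x)$ and $\varphi_{\min}=\min_x\varphi(x)$. Suppose there exist a neighborhood $\mathcal{N}$ of $\hat X$ and constants $\alpha>0$, $L>0$ such that $$\varphi(x)\ge\varphi_{\min}+\alpha\,[\mathrm{dist}(x,\hat X)]^2\quad\text{for all }x\in\mathcal{N},$$ and $$\|C^\top(F(x)-F(z))\|\le L\|x-z\|\quad\text{for all }x\in\mathcal{N},\ z\in\hat X .$$ Then for any $x^*\in X^*\cap\mathcal{N}$, $$\mathrm{dist}(x^*,\hat X)\le 2\delta\sqrt{r}\,L\,\alpha^{-1}.$$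
   Context: $\|\cdot\|$ is the Euclidean norm, $\|\cdot\|_1$ the vector $\ell_1$ norm, $\|\cdot\|_F$ the Frobenius norm, and $\mathrm{dist}(x,S)=\inf_{z\in S}\|x-z\|$. Writing $\varphi_{\min}=\min_x\varphi(x)$ means that the minimum is attained, i.e. $\hat X\neq\emptyset$. *)

theory Defs
  imports "HOL-Analysis.Analysis"
begin

definition argmin_set :: "('a \<Rightarrow> real) \<Rightarrow> 'a set" where
  "argmin_set f = {x. is_arg_min f (\<lambda>_. True) x}"

(* The infimum is the minimum of f once argmin_set f is nonempty (see min_value_eq);
   otherwise the value carries no meaning. *)
definition min_value :: "('a \<Rightarrow> real) \<Rightarrow> real" where
  "min_value f = (INF x. f x)"

definition l1_norm :: "real ^ 'n \<Rightarrow> real" where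
  "l1_norm v = (\<Sum>i\<in>UNIV. \<bar>v $ i\<bar>)"

definition frobenius_norm :: "real ^ 'n ^ 'm \<Rightarrow> real" where
  "frobenius_norm A = sqrt (\<Sum>i\<in>UNIV. \<Sum>j\<in>UNIV. (A $ i $ j)\<^sup>2)"

(* real ^ 'r ^ 'm is the type of matrices with CARD('m) rows and CARD('r) columns. *)
definition phi ::
  "(real ^ 'n \<Rightarrow> real ^ 'm) \<Rightarrow> real ^ 'r ^ 'm \<Rightarrow> real \<Rightarrow> real ^ 'n \<Rightarrow> real" where
  "phi F C \<delta> x =
     (norm (F x))\<^sup>2 + 2 * \<delta> * l1_norm (transpose C *v F x) + (frobenius_norm C)\<^sup>2 * \<delta>\<^sup>2"

lemma argmin_set_iff: "x \<in> argmin_set f \<longleftrightarrow> (\<forall>y. f x \<le> f y)"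
  by (auto simp: argmin_set_def is_arg_min_def not_less)

lemma min_value_eq:
  assumes "z \<in> argmin_set f"
  shows "min_value f = f z"
  unfolding min_value_def
  by (rule cInf_eq_minimum) (use assms in \<open>auto simp: argmin_set_iff\<close>)

end

theory Submission
  imports Defs
begin

text \<open>
  Passing from a minimiser \<open>z\<close> of \<open>\<phi>\<close> to a least-squares point \<open>xs\<close> cannot increase the term
  \<open>\<parallel>F\<parallel>\<^sup>2\<close>, so all growth of \<open>\<phi>\<close> comes from the \<open>\<ell>\<^sub>1\<close> term. By the reverse triangle inequality,
  the comparison \<open>\<parallel>v\<parallel>\<^sub>1 \<le> \<surd>r \<parallel>v\<parallel>\<close> and the Lipschitz condition, that growth is at most
  \<open>2 \<delta> \<surd>r L \<parallel>xs - z\<parallel>\<close>. Quadratic growth bounds it below by \<open>\<alpha> d\<^sup>2\<close>, where \<open>d\<close> is the distance of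
  \<open>xs\<close> to the minimisers of \<open>\<phi>\<close>. The left side of \<open>\<alpha> d\<^sup>2 \<le> 2 \<delta> \<surd>r L \<parallel>xs - z\<parallel>\<close> does not depend
  on \<open>z\<close>, so the infimum over \<open>z\<close> replaces \<open>\<parallel>xs - z\<parallel>\<close> by \<open>d\<close>; if \<open>d > 0\<close>, dividing by \<open>\<alpha> d\<close>
  gives the bound, and if \<open>d = 0\<close> it is trivial.
\<close>

lemma l1_norm_diff_le: "l1_norm u - l1_norm v \<le> l1_norm (u - v)"
  unfolding l1_norm_def sum_subtractf[symmetric]
  by (rule sum_mono) simp

text \<open>Cauchy--Schwarz against the all-ones vector.\<close>
lemma l1_norm_le_sqrt_card_norm:
  fixes v :: "real ^ 'r"
  shows "l1_norm v \<le> sqrt (real CARD('r)) * norm v"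
proof -
  have "(l1_norm v)\<^sup>2 \<le> (\<Sum>i\<in>UNIV. \<bar>v $ i\<bar>\<^sup>2) * real CARD('r)"
    unfolding l1_norm_def by (rule sum_squared_le_sum_of_squares)
  then have "l1_norm v \<le> sqrt ((\<Sum>i\<in>UNIV. \<bar>v $ i\<bar>\<^sup>2) * real CARD('r))"
    by (rule real_le_rsqrt)
  also have "\<dots> = sqrt (real CARD('r)) * norm v"
    by (simp add: norm_vec_def L2_set_def real_sqrt_mult)
  finally show ?thesis .
qed

lemma le_mult_infdist:
  assumes "A \<noteq> {}" "0 \<le> K" and le: "\<And>z. z \<in> A \<Longrightarrow> a \<le> K * dist x z"
  shows "a \<le> K * infdist x A"
proof (cases "K = 0")
  case True
  then show ?thesis using assms by auto
next
  case False
  with assms have "K > 0" by simp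
  with le have "a / K \<le> dist x z" if "z \<in> A" for z
    using that by (simp add: divide_le_eq mult.commute)
  then have "a / K \<le> infdist x A"
    using assms(1) by (auto simp: infdist_notempty intro: cINF_greatest)
  then show ?thesis
    using \<open>K > 0\<close> by (simp add: divide_le_eq mult.commute)
qed

text \<open>
  Since \<open>x\<close> minimises \<open>\<parallel>F\<parallel>\<^sup>2\<close>, the squared terms contribute a nonpositive amount, and the
  Frobenius term cancels; only the \<open>\<ell>\<^sub>1\<close> terms remain to be compared.
\<close>
lemma phi_diff_le_at_least_squares:
  fixes F :: "real ^ 'n \<Rightarrow> real ^ 'm" and C :: "real ^ 'r ^ 'm"
  assumes "\<delta> \<ge> 0" and "x \<in> argmin_set (\<lambda>x. (norm (F x))\<^sup>2)"
  shows "phi F C \<delta> x - phi F C \<delta> z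
    \<le> 2 * \<delta> * sqrt (real CARD('r)) * norm (transpose C *v (F x - F z))"
proof -
  let ?u = "transpose C *v F x" and ?v = "transpose C *v F z"
  have "(norm (F x))\<^sup>2 \<le> (norm (F z))\<^sup>2"
    using assms(2) by (simp add: argmin_set_iff)
  then have "phi F C \<delta> x - phi F C \<delta> z \<le> 2 * \<delta> * (l1_norm ?u - l1_norm ?v)"
    by (simp add: phi_def algebra_simps)
  also have "\<dots> \<le> 2 * \<delta> * (sqrt (real CARD('r)) * norm (?u - ?v))"
    using assms(1) l1_norm_diff_le[of ?u ?v] l1_norm_le_sqrt_card_norm[of "?u - ?v"]
    by (intro mult_left_mono) auto
  finally show ?thesis
    by (simp add: matrix_vector_mult_diff_distrib mult.assoc)
qed

theorem theorem3p4:
  fixes F :: "real ^ 'n \<Rightarrow> real ^ 'm"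
    and C :: "real ^ 'r ^ 'm"
    and \<delta> \<alpha> L :: real
    and N :: "(real ^ 'n) set"
    and xs :: "real ^ 'n"
  assumes "continuous_on UNIV F"
    and "CARD('r) \<le> CARD('m)"
    and "\<delta> \<ge> 0"
    and "argmin_set (phi F C \<delta>) \<noteq> {}"
    and "argmin_set (phi F C \<delta>) \<subseteq> interior N"
    and "\<alpha> > 0"
    and "L > 0"
    and "\<forall>x\<in>N. phi F C \<delta> x \<ge>
           min_value (phi F C \<delta>) + \<alpha> * (infdist x (argmin_set (phi F C \<delta>)))\<^sup>2"
    and "\<forall>x\<in>N. \<forall>z\<in>argmin_set (phi F C \<delta>).
           norm (transpose C *v (F x - F z)) \<le> L * norm (x - z)"
    and "xs \<in> argmin_set (\<lambda>x. (norm (F x))\<^sup>2) \<inter> N"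
  shows "infdist xs (argmin_set (phi F C \<delta>)) \<le> 2 * \<delta> * sqrt (real CARD('r)) * L * inverse \<alpha>"
proof -
  let ?X = "argmin_set (phi F C \<delta>)"
  let ?d = "infdist xs ?X" and ?K = "2 * \<delta> * sqrt (real CARD('r)) * L"
  have xs: "xs \<in> argmin_set (\<lambda>x. (norm (F x))\<^sup>2)" "xs \<in> N"
    using assms(10) by auto
  have K: "0 \<le> ?K"
    using assms(3,7) by simp
  have "\<alpha> * ?d\<^sup>2 \<le> ?K * dist xs z" if z: "z \<in> ?X" for z
  proof -
    have "\<alpha> * ?d\<^sup>2 \<le> phi F C \<delta> xs - phi F C \<delta> z"
      using bspec[OF assms(8) xs(2)] min_value_eq[OF z] by simp
    also have "\<dots> \<le> 2 * \<delta> * sqrt (real CARD('r)) * norm (transpose C *v (F xs - F z))"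
      by (rule phi_diff_le_at_least_squares[OF assms(3) xs(1)])
    also have "\<dots> \<le> 2 * \<delta> * sqrt (real CARD('r)) * (L * norm (xs - z))"
      using assms(3,9) xs(2) z by (intro mult_left_mono) auto
    finally show ?thesis by (simp add: dist_norm mult.assoc)
  qed
  then have quadratic: "\<alpha> * ?d\<^sup>2 \<le> ?K * ?d"
    by (rule le_mult_infdist[OF assms(4) K])
  have "\<alpha> * ?d \<le> ?K"
  proof (cases "?d = 0")
    case True
    with K show ?thesis by simp
  next
    case False
    then have "?d > 0" using infdist_nonneg[of xs ?X] by linarith
    moreover have "(\<alpha> * ?d) * ?d \<le> ?K * ?d"
      using quadratic by (simp add: power2_eq_square mult.assoc)
    ultimately show ?thesis by (rule mult_right_le_imp_le[rotated])
  qed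
  then show ?thesis
    using assms(6) by (simp add: field_simps)
qed

end
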